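(* $\mathsf{SEL}_{K,\Box,B}$ is a sound and complete axiomatization of $\mathcal{L}_{K,\Box,B}$ with respect to the class of topological subset models: for every $\varphi\in\mathcal{L}_{K,\Box,B}$, $\varphi$ is valid in all topological subset models if and only if $\varphi$ is provable in $\mathsf{SEL}_{K,\Box,B}$.
   Context: Language. Fix a countable set PROP of primitive propositions. $\mathcal{L}_{K,\Box,B}$ is generated by $\varphi ::= p \mid \neg\varphi \mid \varphi\wedge\psi \mid K\varphi\mid\Box\varphi\mid B\varphi$, $p\in$ PROP. The connectives $\vee,\to,\leftrightarrow$ are defined as usual and $\Diamond := \neg\Box\neg$. Semantics. A topological subset model is a triple $\mathcal{X}=(X,\mathcal{T},v)$ where $X$ is a nonempty set, $\mathcal{T}$ is a topology on $X$, and $v:\mathrm{PROP}\to 2^X$. An epistemic scenario of $\mathcal X$ is a pair $(x,U)$ with $x\in U\in\mathcal{T}$. Let $\mathit{int}$ and $\mathit{cl}$ denote interior and closure in $(X,\mathcal{T})$, and let $[\![\varphi]\!]^{U}=\{y\in U : (\mathcal{X},y,U)\models\varphi\}$. Truth at an epistemic scenario is defined by: $(\mathcal{X},x,U)\models p$ iff $x\in v(p)$; $(\mathcal{X},x,U)\models\neg\varphi$ iff $(\mathcal{X},x,U)\not\models\varphi$; $(\mathcal{X},x,U)\models\varphi\wedge\psi$ iff $(\mathcal{X},x,U)\models\varphi$ and $(\mathcal{X},x,U)\models\psi$; $(\mathcal{X},x,U)\models K\varphi$ iff $(\mathcal{X},y,U)\models\varphi$ for all $y\in U$; $(\mathcal{X},x,U)\models\Box\varphi$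 iff $x\in\mathit{int}([\![\varphi]\!]^{U})$; $(\mathcal{X},x,U)\models B\varphi$ iff $U\subseteq\mathit{cl}(\mathit{int}([\![\varphi]\!]^{U}))$. A formula is valid in $\mathcal{X}$ if it is true at every epistemic scenario of $\mathcal X$. The logic $\mathsf{SEL}_{K,\Box,B}$ is the Hilbert system (schemes and rules ranging over formulas of $\mathcal{L}_{K,\Box,B}$) consisting of classical propositional logic (with modus ponens) plus: the $\mathsf{S5}$ principles for $K$: $K(\varphi\to\psi)\to(K\varphi\to K\psi)$, $K\varphi\to\varphi$, $K\varphi\to KK\varphi$, $\neg K\varphi\to K\neg K\varphi$, and the rule "from $\vdash\varphi$ infer $\vdash K\varphi$"; the $\mathsf{S4}$ principles for $\Box$: $\Box(\varphi\to\psi)\to(\Box\varphi\to\Box\psi)$, $\Box\varphi\to\varphi$, $\Box\varphi\to\Box\Box\varphi$, and the rule "from $\vdash\varphi$ infer $\vdash\Box\varphi$"; the schemes $(\mathrm{KI})$ $K\varphi\to\Box\varphi$; $(\mathrm{K}_B)$ $B(\varphi\to\psi)\to(B\varphi\to B\psi)$; $(\mathrm{sPI})$ $B\varphi\to KB\varphi$; $(\mathrm{KB})$ $K\varphi\to B\varphi$; $(\mathrm{RB})$ $B\varphi\to B\Box\varphi$; $(\mathrm{wF})$ $B\varphi\to\Diamond\varphi$; $(\mathrm{CB})$ $B(\Box\varphi\vee\Box\neg\Box\varphi)$. *)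

theory Defs
  imports "HOL-Analysis.Abstract_Topology" "HOL-Library.Countable"
begin

datatype 'p fm =
    Atom 'p
  | Neg "'p fm"  (\<open>\<^bold>\<not> _\<close> [80] 80)
  | Conj "'p fm" "'p fm"  (infixr \<open>\<^bold>\<and>\<close> 70)
  | Know "'p fm"
  | Box "'p fm"
  | Bel "'p fm"

abbreviation Disj :: "'p fm \<Rightarrow> 'p fm \<Rightarrow> 'p fm"  (infixr \<open>\<^bold>\<or>\<close> 65) where
  "\<phi> \<^bold>\<or> \<psi> \<equiv> \<^bold>\<not> (\<^bold>\<not> \<phi> \<^bold>\<and> \<^bold>\<not> \<psi>)"

abbreviation Imp :: "'p fm \<Rightarrow> 'p fm \<Rightarrow> 'p fm"  (infixr \<open>\<^bold>\<rightarrow>\<close> 60) where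
  "\<phi> \<^bold>\<rightarrow> \<psi> \<equiv> \<^bold>\<not> (\<phi> \<^bold>\<and> \<^bold>\<not> \<psi>)"

abbreviation Dia :: "'p fm \<Rightarrow> 'p fm" where
  "Dia \<phi> \<equiv> \<^bold>\<not> Box (\<^bold>\<not> \<phi>)"

(* The carrier of a model is the topspace of T, which may be any nonempty subset of the
   type 'x. *)
definition topological_subset_model :: "'x topology \<Rightarrow> ('p \<Rightarrow> 'x set) \<Rightarrow> bool" where
  "topological_subset_model T v \<longleftrightarrow> topspace T \<noteq> {} \<and> (\<forall>p. v p \<subseteq> topspace T)"

definition epistemic_scenario :: "'x topology \<Rightarrow> 'x \<Rightarrow> 'x set \<Rightarrow> bool" where
  "epistemic_scenario T x U \<longleftrightarrow> x \<in> U \<and> openin T U"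

(* The value is meaningful only when (x, U) is an epistemic scenario of T; all recursive
   calls stay within scenarios (y, U) for the same U. *)
fun sat :: "'x topology \<Rightarrow> ('p \<Rightarrow> 'x set) \<Rightarrow> 'x \<Rightarrow> 'x set \<Rightarrow> 'p fm \<Rightarrow> bool" where
  "sat T v x U (Atom p) \<longleftrightarrow> x \<in> v p"
| "sat T v x U (\<^bold>\<not> \<phi>) \<longleftrightarrow> \<not> sat T v x U \<phi>"
| "sat T v x U (\<phi> \<^bold>\<and> \<psi>) \<longleftrightarrow> sat T v x U \<phi> \<and> sat T v x U \<psi>"
| "sat T v x U (Know \<phi>) \<longleftrightarrow> (\<forall>y\<in>U. sat T v y U \<phi>)"
| "sat T v x U (Box \<phi>) \<longleftrightarrow> x \<in> T interior_of {y \<in> U. sat T v y U \<phi>}"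
| "sat T v x U (Bel \<phi>) \<longleftrightarrow> U \<subseteq> T closure_of (T interior_of {y \<in> U. sat T v y U \<phi>})"

definition valid_in :: "'x topology \<Rightarrow> ('p \<Rightarrow> 'x set) \<Rightarrow> 'p fm \<Rightarrow> bool" where
  "valid_in T v \<phi> \<longleftrightarrow> (\<forall>x U. epistemic_scenario T x U \<longrightarrow> sat T v x U \<phi>)"

(* Propositional evaluation, with atoms and modal formulas Know, Box, Bel as the
   propositional letters; tautologies are thus all substitution instances of
   propositional tautologies. *)
fun prop_eval :: "('p fm \<Rightarrow> bool) \<Rightarrow> 'p fm \<Rightarrow> bool" where
  "prop_eval e (\<^bold>\<not> \<phi>) \<longleftrightarrow> \<not> prop_eval e \<phi>"
| "prop_eval e (\<phi> \<^bold>\<and> \<psi>) \<longleftrightarrow> prop_eval e \<phi> \<and> prop_eval e \<psi>"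
| "prop_eval e \<phi> \<longleftrightarrow> e \<phi>"

definition tautology :: "'p fm \<Rightarrow> bool" where
  "tautology \<phi> \<longleftrightarrow> (\<forall>e. prop_eval e \<phi>)"

inductive SEL :: "'p fm \<Rightarrow> bool"  (\<open>\<turnstile> _\<close> [50] 50) where
  CPL: "tautology \<phi> \<Longrightarrow> \<turnstile> \<phi>"
| MP: "\<turnstile> \<phi> \<^bold>\<rightarrow> \<psi> \<Longrightarrow> \<turnstile> \<phi> \<Longrightarrow> \<turnstile> \<psi>"
| K_K: "\<turnstile> Know (\<phi> \<^bold>\<rightarrow> \<psi>) \<^bold>\<rightarrow> (Know \<phi> \<^bold>\<rightarrow> Know \<psi>)"
| T_K: "\<turnstile> Know \<phi> \<^bold>\<rightarrow> \<phi>"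
| Four_K: "\<turnstile> Know \<phi> \<^bold>\<rightarrow> Know (Know \<phi>)"
| Five_K: "\<turnstile> \<^bold>\<not> Know \<phi> \<^bold>\<rightarrow> Know (\<^bold>\<not> Know \<phi>)"
| Nec_K: "\<turnstile> \<phi> \<Longrightarrow> \<turnstile> Know \<phi>"
| K_Box: "\<turnstile> Box (\<phi> \<^bold>\<rightarrow> \<psi>) \<^bold>\<rightarrow> (Box \<phi> \<^bold>\<rightarrow> Box \<psi>)"
| T_Box: "\<turnstile> Box \<phi> \<^bold>\<rightarrow> \<phi>"
| Four_Box: "\<turnstile> Box \<phi> \<^bold>\<rightarrow> Box (Box \<phi>)"
| Nec_Box: "\<turnstile> \<phi> \<Longrightarrow> \<turnstile> Box \<phi>"
| KI: "\<turnstile> Know \<phi> \<^bold>\<rightarrow> Box \<phi>"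
| K_B: "\<turnstile> Bel (\<phi> \<^bold>\<rightarrow> \<psi>) \<^bold>\<rightarrow> (Bel \<phi> \<^bold>\<rightarrow> Bel \<psi>)"
| sPI: "\<turnstile> Bel \<phi> \<^bold>\<rightarrow> Know (Bel \<phi>)"
| KB: "\<turnstile> Know \<phi> \<^bold>\<rightarrow> Bel \<phi>"
| RB: "\<turnstile> Bel \<phi> \<^bold>\<rightarrow> Bel (Box \<phi>)"
| wF: "\<turnstile> Bel \<phi> \<^bold>\<rightarrow> Dia \<phi>"
| CB: "\<turnstile> Bel (Box \<phi> \<^bold>\<or> Box (\<^bold>\<not> Box \<phi>))"

end

theory Submission imports Defs begin

text \<open>
  Semantically \<open>B\<phi>\<close> says that the interior of \<open>\<phi>\<close> is dense in \<open>U\<close>, that is \<open>K\<diamond>\<box>\<phi>\<close>.  The logic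
  proves the same equivalence: (RB), (sPI) and (wF) give \<open>B\<phi> \<rightarrow> K\<diamond>\<box>\<phi>\<close>, and \<open>K\<diamond>\<box>\<phi>\<close> refutes
  the second disjunct of (CB) inside \<open>B\<close>, leaving \<open>B\<box>\<phi>\<close>.  It therefore suffices to find a
  canonical model for \<open>K\<close> and \<open>\<box>\<close>: a \<open>K\<close>-class of maximal consistent sets, which by (KI) is closed
  under the accessibility relation of \<open>\<box>\<close>, with the topology of up-sets of that relation.
\<close>

section \<open>Soundness\<close>

lemma sat_Box_iff:
  "sat T v x U (Box \<phi>) \<longleftrightarrow> (\<exists>V. openin T V \<and> x \<in> V \<and> V \<subseteq> U \<and> (\<forall>y\<in>V. sat T v y U \<phi>))"
  by (auto simp: interior_of_def)

lemma sat_Dia_iff: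
  "sat T v x U (Dia \<phi>) \<longleftrightarrow>
    (\<forall>V. openin T V \<and> x \<in> V \<and> V \<subseteq> U \<longrightarrow> (\<exists>y\<in>V. sat T v y U \<phi>))"
  unfolding sat.simps(2) sat_Box_iff by blast

text \<open>Closure is the complement of the interior of the complement, and since \<open>U\<close>
  is open the complement may be taken inside \<open>U\<close>. The truth lemma uses this as the
  semantic half of the reduction of belief.\<close>

lemma sat_Bel_iff_Know_Dia_Box:
  assumes "openin T U"
  shows "sat T v x U (Bel \<phi>) \<longleftrightarrow> sat T v x U (Know (Dia (Box \<phi>)))"
proof -
  have "y \<in> T closure_of S \<longleftrightarrow> y \<notin> T interior_of {z \<in> U. z \<notin> S}" if "y \<in> U" for y S
  proof -
    have "T interior_of {z \<in> U. z \<notin> S} = U \<inter> T interior_of (topspace T - S)"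
    proof -
      have "{z \<in> U. z \<notin> S} = U \<inter> (topspace T - S)"
        using openin_subset[OF assms] by auto
      then show ?thesis
        using assms by (simp add: interior_of_Int interior_of_openin)
    qed
    moreover have "y \<in> topspace T"
      using that openin_subset[OF assms] by auto
    ultimately show ?thesis
      using that by (simp add: closure_of_interior_of)
  qed
  then show ?thesis
    by auto
qed

text \<open>Density of the interior in terms of nonempty open sets alone: the soundness of the
  belief axioms then becomes a matter of shrinking open sets.\<close>

lemma sat_Bel_iff:
  assumes "openin T U"
  shows "sat T v x U (Bel \<phi>) \<longleftrightarrow>
    (\<forall>V. openin T V \<and> V \<subseteq> U \<and> V \<noteq> {} \<longrightarrow>
      (\<exists>W. openin T W \<and> W \<subseteq> V \<and> W \<noteq> {} \<and> (\<forall>y\<in>W. sat T v y U \<phi>)))" (is "_ \<longleftrightarrow> ?R")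
proof -
  have "sat T v x U (Bel \<phi>) \<longleftrightarrow>
    (\<forall>y\<in>U. \<forall>V. openin T V \<and> y \<in> V \<and> V \<subseteq> U \<longrightarrow> (\<exists>z\<in>V. sat T v z U (Box \<phi>)))"
    unfolding sat_Bel_iff_Know_Dia_Box[OF assms] sat.simps(4) sat_Dia_iff ..
  also have "\<dots> \<longleftrightarrow> ?R"
  proof
    assume L: "\<forall>y\<in>U. \<forall>V. openin T V \<and> y \<in> V \<and> V \<subseteq> U \<longrightarrow> (\<exists>z\<in>V. sat T v z U (Box \<phi>))"
    show ?R
    proof (intro allI impI)
      fix V assume V: "openin T V \<and> V \<subseteq> U \<and> V \<noteq> {}"
      then obtain z where z: "z \<in> V" "sat T v z U (Box \<phi>)"
        using L by blast
      then obtain W where "openin T W" "z \<in> W" "\<forall>y\<in>W. sat T v y U \<phi>"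
        by (auto simp only: sat_Box_iff)
      then show "\<exists>W. openin T W \<and> W \<subseteq> V \<and> W \<noteq> {} \<and> (\<forall>y\<in>W. sat T v y U \<phi>)"
        using V z by (intro exI[of _ "V \<inter> W"]) auto
    qed
  next
    assume R: ?R
    show "\<forall>y\<in>U. \<forall>V. openin T V \<and> y \<in> V \<and> V \<subseteq> U \<longrightarrow> (\<exists>z\<in>V. sat T v z U (Box \<phi>))"
    proof (intro ballI allI impI)
      fix y V assume V: "openin T V \<and> y \<in> V \<and> V \<subseteq> U"
      then obtain W z where W: "openin T W" "W \<subseteq> V" "z \<in> W" "\<forall>y\<in>W. sat T v y U \<phi>"
        using R[rule_format, of V] by blast
      then have "sat T v z U (Box \<phi>)"
        using V by (auto simp only: sat_Box_iff)
      then show "\<exists>z\<in>V. sat T v z U (Box \<phi>)"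
        using W by blast
    qed
  qed
  finally show ?thesis .
qed

text \<open>Truth at a fixed scenario is itself a propositional evaluation.\<close>

lemma sat_tautology:
  assumes "tautology \<phi>"
  shows "sat T v x U \<phi>"
proof -
  have "prop_eval (sat T v x U) \<phi> = sat T v x U \<phi>"
    by (induction \<phi>) simp_all
  then show ?thesis
    using assms by (simp add: tautology_def)
qed

lemma sat_Imp: "sat T v x U (\<phi> \<^bold>\<rightarrow> \<psi>) \<longleftrightarrow> (sat T v x U \<phi> \<longrightarrow> sat T v x U \<psi>)"
  by simp

lemma sat_CB:
  assumes U: "openin T U"
  shows "sat T v x U (Bel (Box \<phi> \<^bold>\<or> Box (\<^bold>\<not> Box \<phi>)))"
  unfolding sat_Bel_iff[OF U]
proof (intro allI impI)
  fix V assume V: "openin T V \<and> V \<subseteq> U \<and> V \<noteq> {}"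
  let ?P = "\<lambda>W. openin T W \<and> W \<subseteq> V \<and> W \<noteq> {} \<and>
    (\<forall>y\<in>W. sat T v y U (Box \<phi> \<^bold>\<or> Box (\<^bold>\<not> Box \<phi>)))"
  show "\<exists>W. ?P W"
  \<comment> \<open>If some point of \<open>V\<close> satisfies \<open>Box \<phi>\<close>, a
    neighbourhood of it inside \<open>V\<close> realises the first disjunct. Otherwise
    \<open>V\<close> itself realises the second.\<close>
  proof (cases "\<exists>z\<in>V. sat T v z U (Box \<phi>)")
    case True
    then obtain z W where "z \<in> V" "openin T W" "z \<in> W" "W \<subseteq> U" "\<forall>y\<in>W. sat T v y U \<phi>"
      by (auto simp only: sat_Box_iff)
    then have "?P (V \<inter> W)"
      using V unfolding sat.simps(2,3) sat_Box_iff by blast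
    then show ?thesis ..
  next
    case False
    then have "?P V"
      \<comment> \<open>The instantiation opens only the outer box of the second disjunct and keeps
        \<open>Box \<phi>\<close> intact, as it stands in the case assumption.\<close>
      using V unfolding sat.simps(2,3) sat_Box_iff[of _ _ _ _ "\<^bold>\<not> _"] by blast
    then show ?thesis ..
  qed
qed

lemma soundness:
  assumes "\<turnstile> \<phi>" and U: "openin T U" and "x \<in> U"
  shows "sat T v x U \<phi>"
  using assms(1,3)
proof (induction arbitrary: x rule: SEL.induct)
  case (CPL \<phi>)
  then show ?case by (simp add: sat_tautology)
next
  case (MP \<phi> \<psi>)
  then show ?case by (meson sat_Imp)
next
  case (K_Box \<phi> \<psi>)
  show ?case
    unfolding sat_Imp sat_Box_iff
  proof (intro impI, elim exE conjE)
    fix V W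
    assume "openin T V" "openin T W" "x \<in> V" "x \<in> W" "V \<subseteq> U" "W \<subseteq> U"
      "\<forall>y\<in>V. sat T v y U \<phi> \<longrightarrow> sat T v y U \<psi>" "\<forall>y\<in>W. sat T v y U \<phi>"
    then show "\<exists>V. openin T V \<and> x \<in> V \<and> V \<subseteq> U \<and> (\<forall>y\<in>V. sat T v y U \<psi>)"
      by (intro exI[of _ "V \<inter> W"]) auto
  qed
next
  case (T_Box \<phi>)
  then show ?case unfolding sat_Imp sat_Box_iff by blast
next
  case (Four_Box \<phi>)
  then show ?case unfolding sat_Imp sat_Box_iff by blast
next
  case (Nec_Box \<phi>)
  then show ?case unfolding sat_Box_iff using U by blast
next
  case (KI \<phi>)
  then show ?case unfolding sat_Imp sat_Box_iff sat.simps(4) using U by blast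
next
  case (K_B \<phi> \<psi>)
  show ?case
    unfolding sat_Imp sat_Bel_iff[OF U]
  proof (intro impI allI)
    fix V
    assume dense: "\<forall>V. openin T V \<and> V \<subseteq> U \<and> V \<noteq> {} \<longrightarrow>
        (\<exists>W. openin T W \<and> W \<subseteq> V \<and> W \<noteq> {} \<and> (\<forall>y\<in>W. sat T v y U \<phi> \<longrightarrow> sat T v y U \<psi>))"
      "\<forall>V. openin T V \<and> V \<subseteq> U \<and> V \<noteq> {} \<longrightarrow>
        (\<exists>W. openin T W \<and> W \<subseteq> V \<and> W \<noteq> {} \<and> (\<forall>y\<in>W. sat T v y U \<phi>))"
      and V: "openin T V \<and> V \<subseteq> U \<and> V \<noteq> {}"
    \<comment> \<open>Shrink twice: \<open>V\<close> to a set where \<phi> holds, then that set to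
      one where the implication holds as well.\<close>
    obtain W where W: "openin T W" "W \<subseteq> V" "W \<noteq> {}" "\<forall>y\<in>W. sat T v y U \<phi>"
      using dense(2) V by meson
    then obtain W' where "openin T W'" "W' \<subseteq> W" "W' \<noteq> {}"
      "\<forall>y\<in>W'. sat T v y U \<phi> \<longrightarrow> sat T v y U \<psi>"
      using dense(1)[rule_format, of W] V by auto
    with W show "\<exists>W. openin T W \<and> W \<subseteq> V \<and> W \<noteq> {} \<and> (\<forall>y\<in>W. sat T v y U \<psi>)"
      by blast
  qed
next
  case (KB \<phi>)
  then show ?case unfolding sat_Imp sat_Bel_iff[OF U] sat.simps(4) by blast
next
  case (RB \<phi>)
  \<comment> \<open>An open set of \<phi>-points already consists of
    \<open>Box \<phi>\<close>-points, so the same witness \<open>W\<close> serves.\<close>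
  have "sat T v y U (Box \<phi>)" if "openin T W" "W \<subseteq> U" "\<forall>y\<in>W. sat T v y U \<phi>" "y \<in> W" for W y
    unfolding sat_Box_iff using that by blast
  then show ?case unfolding sat_Imp sat_Bel_iff[OF U] by (meson order_trans)
next
  case (wF \<phi>)
  have "sat T v y U \<phi>" if "sat T v y U (Box \<phi>)" for y
    using that by (auto simp only: sat_Box_iff)
  then show ?case
    using wF unfolding sat_Imp sat_Bel_iff_Know_Dia_Box[OF U]
    unfolding sat.simps(4) sat_Dia_iff by blast
next
  case (CB \<phi>)
  show ?case by (rule sat_CB[OF U])
qed auto

section \<open>Maximal consistent sets\<close>

text \<open>Local consequence: modus ponens is the only rule applied to hypotheses, and
  necessitation is confined to theorems. This is what makes the deduction theorem hold.\<close>

inductive deriv :: "'p fm set \<Rightarrow> 'p fm \<Rightarrow> bool"  (infix \<open>\<tturnstile>\<close> 50) for G where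
  prov: "\<turnstile> \<phi> \<Longrightarrow> G \<tturnstile> \<phi>"
| asm: "\<phi> \<in> G \<Longrightarrow> G \<tturnstile> \<phi>"
| mp: "G \<tturnstile> \<phi> \<^bold>\<rightarrow> \<psi> \<Longrightarrow> G \<tturnstile> \<phi> \<Longrightarrow> G \<tturnstile> \<psi>"

lemma deriv_empty: "{} \<tturnstile> \<phi> \<Longrightarrow> \<turnstile> \<phi>"
  by (induction rule: deriv.induct) (auto intro: MP)

lemma deriv_mono: "G \<tturnstile> \<phi> \<Longrightarrow> G \<subseteq> H \<Longrightarrow> H \<tturnstile> \<phi>"
  by (induction rule: deriv.induct) (auto intro: deriv.intros)

lemma deriv_tautology: "tautology \<phi> \<Longrightarrow> G \<tturnstile> \<phi>"
  by (intro deriv.prov CPL)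

lemma deduction:
  assumes "insert \<psi> G \<tturnstile> \<phi>"
  shows "G \<tturnstile> \<psi> \<^bold>\<rightarrow> \<phi>"
  using assms
proof (induction rule: deriv.induct)
  case (prov \<phi>)
  have "G \<tturnstile> \<phi> \<^bold>\<rightarrow> (\<psi> \<^bold>\<rightarrow> \<phi>)"
    by (rule deriv_tautology) (simp add: tautology_def)
  then show ?case using deriv.prov[OF prov] by (rule deriv.mp)
next
  case (asm \<phi>)
  have "G \<tturnstile> \<psi> \<^bold>\<rightarrow> \<psi>" "G \<tturnstile> \<phi> \<^bold>\<rightarrow> (\<psi> \<^bold>\<rightarrow> \<phi>)"
    by (rule deriv_tautology, simp add: tautology_def)+
  then show ?case using asm by (blast intro: deriv.intros)
next
  case (mp \<phi> \<chi>)
  have "G \<tturnstile> (\<psi> \<^bold>\<rightarrow> (\<phi> \<^bold>\<rightarrow> \<chi>)) \<^bold>\<rightarrow> ((\<psi> \<^bold>\<rightarrow> \<phi>) \<^bold>\<rightarrow> (\<psi> \<^bold>\<rightarrow> \<chi>))"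
    by (rule deriv_tautology) (simp add: tautology_def)
  then show ?case using mp.IH by (meson deriv.mp)
qed

text \<open>Stands in for the finiteness of derivations: the two premises of modus ponens are
  derived from two members of the chain, and the larger one derives both.\<close>

lemma deriv_Union_chain:
  assumes "\<Union>C \<tturnstile> \<phi>" "subset.chain A C" "C \<noteq> {}"
  shows "\<exists>G\<in>C. G \<tturnstile> \<phi>"
  using assms(1)
proof (induction rule: deriv.induct)
  case (prov \<phi>)
  then show ?case using assms(3) by (blast intro: deriv.prov)
next
  case (asm \<phi>)
  then show ?case by (blast intro: deriv.asm)
next
  case (mp \<phi> \<psi>)
  then obtain G H where "G \<in> C" "H \<in> C" "G \<tturnstile> \<phi> \<^bold>\<rightarrow> \<psi>" "H \<tturnstile> \<phi>"
    by blast
  moreover from this have "G \<subseteq> H \<or> H \<subseteq> G"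
    using assms(2) by (auto simp: subset_chain_def)
  ultimately show ?case
    by (meson deriv.mp deriv_mono)
qed

definition mcs :: "'p fm set \<Rightarrow> bool" where
  "mcs M \<longleftrightarrow> (\<forall>\<phi>. M \<tturnstile> \<phi> \<longrightarrow> \<phi> \<in> M) \<and> (\<forall>\<phi>. \<^bold>\<not> \<phi> \<in> M \<longleftrightarrow> \<phi> \<notin> M)"

text \<open>Zorn's lemma is applied to the supersets of \<open>G\<close> that do not derive \<phi>.
  A set maximal among these turns out to be maximal consistent.\<close>

lemma lindenbaum:
  assumes "\<not> G \<tturnstile> \<phi>"
  shows "\<exists>M. mcs M \<and> G \<subseteq> M \<and> \<phi> \<notin> M"
proof -
  let ?A = "{H. G \<subseteq> H \<and> \<not> H \<tturnstile> \<phi>}"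
  have "\<exists>M\<in>?A. \<forall>H\<in>?A. M \<subseteq> H \<longrightarrow> H = M"
  proof (rule subset_Zorn_nonempty)
    show "?A \<noteq> {}" using assms by blast
    fix C assume C: "C \<noteq> {}" "subset.chain ?A C"
    then have "C \<subseteq> ?A" by (simp add: subset_chain_def)
    then show "\<Union>C \<in> ?A"
      using C deriv_Union_chain[OF _ C(2,1)] by blast
  qed
  then obtain M where M: "G \<subseteq> M" "\<not> M \<tturnstile> \<phi>"
    and "\<forall>H\<in>?A. M \<subseteq> H \<longrightarrow> H = M"
    by auto
  then have max: "H = M" if "M \<subseteq> H" "\<not> H \<tturnstile> \<phi>" for H
    using that order_trans[OF M(1)] by simp
  \<comment> \<open>By maximality, adding any new formula makes \<phi> derivable. Closure and
    completeness of \<open>M\<close> both follow from this.\<close>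
  have imp: "M \<tturnstile> \<psi> \<^bold>\<rightarrow> \<phi>" if "\<psi> \<notin> M" for \<psi>
  proof (rule deduction, rule ccontr)
    assume "\<not> insert \<psi> M \<tturnstile> \<phi>"
    then have "insert \<psi> M = M"
      by (intro max) auto
    then show False using that by blast
  qed
  have closed: "\<psi> \<in> M" if "M \<tturnstile> \<psi>" for \<psi>
    using deriv.mp[OF imp that] M(2) by blast
  have "\<^bold>\<not> \<psi> \<notin> M" if "\<psi> \<in> M" for \<psi>
  proof
    assume "\<^bold>\<not> \<psi> \<in> M"
    moreover have "M \<tturnstile> \<psi> \<^bold>\<rightarrow> (\<^bold>\<not> \<psi> \<^bold>\<rightarrow> \<phi>)"
      by (rule deriv_tautology) (simp add: tautology_def)
    ultimately show False
      using that M(2) by (meson deriv.asm deriv.mp)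
  qed
  moreover have "\<^bold>\<not> \<psi> \<in> M" if "\<psi> \<notin> M" for \<psi>
  proof (rule ccontr)
    assume "\<^bold>\<not> \<psi> \<notin> M"
    moreover have "M \<tturnstile> (\<psi> \<^bold>\<rightarrow> \<phi>) \<^bold>\<rightarrow> ((\<^bold>\<not> \<psi> \<^bold>\<rightarrow> \<phi>) \<^bold>\<rightarrow> \<phi>)"
      by (rule deriv_tautology) (auto simp: tautology_def)
    ultimately show False
      using that imp M(2) by (meson deriv.mp)
  qed
  ultimately have "mcs M"
    using closed unfolding mcs_def by blast
  then show ?thesis
    using M deriv.asm by blast
qed

lemma mcs_Neg: "mcs M \<Longrightarrow> \<^bold>\<not> \<phi> \<in> M \<longleftrightarrow> \<phi> \<notin> M"
  by (simp add: mcs_def)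

lemma mcs_thm: "mcs M \<Longrightarrow> \<turnstile> \<phi> \<Longrightarrow> \<phi> \<in> M"
  unfolding mcs_def by (blast intro: deriv.prov)

lemma mcs_mp: "mcs M \<Longrightarrow> \<phi> \<^bold>\<rightarrow> \<psi> \<in> M \<Longrightarrow> \<phi> \<in> M \<Longrightarrow> \<psi> \<in> M"
  unfolding mcs_def using deriv.mp[OF deriv.asm deriv.asm] by blast

lemma mcs_step: "mcs M \<Longrightarrow> \<turnstile> \<phi> \<^bold>\<rightarrow> \<psi> \<Longrightarrow> \<phi> \<in> M \<Longrightarrow> \<psi> \<in> M"
  by (rule mcs_mp[OF _ mcs_thm])

lemma mcs_Conj:
  assumes M: "mcs M"
  shows "\<phi> \<^bold>\<and> \<psi> \<in> M \<longleftrightarrow> \<phi> \<in> M \<and> \<psi> \<in> M"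
proof -
  have "\<turnstile> \<phi> \<^bold>\<and> \<psi> \<^bold>\<rightarrow> \<phi>" "\<turnstile> \<phi> \<^bold>\<and> \<psi> \<^bold>\<rightarrow> \<psi>" "\<turnstile> \<phi> \<^bold>\<rightarrow> (\<psi> \<^bold>\<rightarrow> \<phi> \<^bold>\<and> \<psi>)"
    by (rule CPL, simp add: tautology_def)+
  then show ?thesis
    using mcs_step[OF M] mcs_mp[OF M] by blast
qed

text \<open>For a normal modality \<open>F\<close>, the formulas whose \<open>F\<close>-image lies
  in \<open>M\<close> are closed under derivation. They therefore do not derive \<phi>, and
  Lindenbaum's lemma extends them. Stated for any \<open>F\<close> to cover both \<open>Know\<close>
  and \<open>Box\<close>.\<close>

lemma mcs_normal_witness:
  assumes N: "\<And>\<phi>. \<turnstile> \<phi> \<Longrightarrow> \<turnstile> F \<phi>"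
    and K: "\<And>\<phi> \<psi>. \<turnstile> F (\<phi> \<^bold>\<rightarrow> \<psi>) \<^bold>\<rightarrow> (F \<phi> \<^bold>\<rightarrow> F \<psi>)"
    and M: "mcs M" "F \<phi> \<notin> M"
  shows "\<exists>N. mcs N \<and> {\<psi>. F \<psi> \<in> M} \<subseteq> N \<and> \<phi> \<notin> N"
proof (rule lindenbaum)
  have "F \<psi> \<in> M" if "{\<psi>. F \<psi> \<in> M} \<tturnstile> \<psi>" for \<psi>
    using that
  proof (induction rule: deriv.induct)
    case (prov \<psi>)
    then show ?case using mcs_thm[OF M(1) N] by blast
  next
    case (mp \<psi> \<chi>)
    then show ?case using mcs_mp[OF M(1) mcs_step[OF M(1) K]] by blast
  qed simp
  then show "\<not> {\<psi>. F \<psi> \<in> M} \<tturnstile> \<phi>"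
    using M(2) by blast
qed

lemmas mcs_Know_witness = mcs_normal_witness[of Know, OF Nec_K K_K]
lemmas mcs_Box_witness = mcs_normal_witness[of Box, OF Nec_Box K_Box]

section \<open>Reduction of belief to knowledge and box inside the logic\<close>

lemma Bel_mono: "\<turnstile> \<phi> \<^bold>\<rightarrow> \<psi> \<Longrightarrow> \<turnstile> Bel \<phi> \<^bold>\<rightarrow> Bel \<psi>"
  by (rule MP[OF K_B MP[OF KB Nec_K]])

lemma Know_mono: "\<turnstile> \<phi> \<^bold>\<rightarrow> \<psi> \<Longrightarrow> \<turnstile> Know \<phi> \<^bold>\<rightarrow> Know \<psi>"
  by (rule MP[OF K_K Nec_K])

lemma mcs_Bel_iff_Know_Dia_Box:
  assumes M: "mcs M"
  shows "Bel \<phi> \<in> M \<longleftrightarrow> Know (Dia (Box \<phi>)) \<in> M"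
proof
  assume "Bel \<phi> \<in> M"
  then have "Know (Bel (Box \<phi>)) \<in> M"
    by (rule mcs_step[OF M sPI, OF mcs_step[OF M RB]])
  then show "Know (Dia (Box \<phi>)) \<in> M"
    by (rule mcs_step[OF M Know_mono[OF wF]])
next
  assume "Know (Dia (Box \<phi>)) \<in> M"
  then have "Bel (Dia (Box \<phi>)) \<in> M"
    by (rule mcs_step[OF M KB])
  \<comment> \<open>\<open>Dia (Box \<phi>)\<close> is literally the negation of the second
    disjunct, so this is a disjunctive syllogism with boxed formulas as letters.\<close>
  moreover have "\<turnstile> Dia (Box \<phi>) \<^bold>\<rightarrow> ((Box \<phi> \<^bold>\<or> Box (\<^bold>\<not> Box \<phi>)) \<^bold>\<rightarrow> Box \<phi>)"
    by (rule CPL) (auto simp: tautology_def)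
  ultimately have "Bel ((Box \<phi> \<^bold>\<or> Box (\<^bold>\<not> Box \<phi>)) \<^bold>\<rightarrow> Box \<phi>) \<in> M"
    using mcs_step[OF M Bel_mono] by blast
  then have "Bel (Box \<phi>) \<in> M"
    by (rule mcs_mp[OF M mcs_step[OF M K_B] mcs_thm[OF M CB]])
  then show "Bel \<phi> \<in> M"
    by (rule mcs_step[OF M Bel_mono[OF T_Box]])
qed

section \<open>The canonical model\<close>

text \<open>The Alexandroff topology of the relation \<open>R\<close> restricted to
  \<open>U\<close>.\<close>

definition upset_topology :: "'a set \<Rightarrow> ('a \<Rightarrow> 'a \<Rightarrow> bool) \<Rightarrow> 'a topology" where
  "upset_topology U R = topology (\<lambda>S. S \<subseteq> U \<and> (\<forall>x\<in>S. \<forall>y\<in>U. R x y \<longrightarrow> y \<in> S))"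

lemma openin_upset_topology:
  "openin (upset_topology U R) S \<longleftrightarrow> S \<subseteq> U \<and> (\<forall>x\<in>S. \<forall>y\<in>U. R x y \<longrightarrow> y \<in> S)"
proof -
  have "istopology (\<lambda>S. S \<subseteq> U \<and> (\<forall>x\<in>S. \<forall>y\<in>U. R x y \<longrightarrow> y \<in> S))"
    unfolding istopology_def by blast
  then show ?thesis
    by (simp add: upset_topology_def topology_inverse')
qed

definition box_rel :: "'p fm set \<Rightarrow> 'p fm set \<Rightarrow> bool" where
  "box_rel M N \<longleftrightarrow> {\<psi>. Box \<psi> \<in> M} \<subseteq> N"

text \<open>The equivalence class of \<open>M\<close> under the canonical S5 relation, written
  symmetrically as agreement on known formulas.\<close>

definition know_class :: "'p fm set \<Rightarrow> 'p fm set set" where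
  "know_class M = {N. mcs N \<and> (\<forall>\<psi>. Know \<psi> \<in> N \<longleftrightarrow> Know \<psi> \<in> M)}"

definition canonical_topology :: "'p fm set \<Rightarrow> 'p fm set topology" where
  "canonical_topology M = upset_topology (know_class M) box_rel"

definition canonical_valuation :: "'p fm set \<Rightarrow> 'p \<Rightarrow> 'p fm set set" where
  "canonical_valuation M p = {N \<in> know_class M. Atom p \<in> N}"

text \<open>The usual one-sided canonical relation suffices for membership: \<open>Four_K\<close>
  carries \<open>Know\<close>-formulas from \<open>N\<close> to \<open>L\<close>, and
  \<open>Five_K\<close> excludes new ones in \<open>L\<close>.\<close>

lemma know_classI:
  assumes N: "N \<in> know_class M" and L: "mcs L" "{\<psi>. Know \<psi> \<in> N} \<subseteq> L"
  shows "L \<in> know_class M"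
proof -
  have mcsN: "mcs N" using N by (simp add: know_class_def)
  have "Know \<psi> \<in> L" if "Know \<psi> \<in> N" for \<psi>
    using mcs_step[OF mcsN Four_K that] L(2) by blast
  moreover have "Know \<psi> \<notin> L" if "Know \<psi> \<notin> N" for \<psi>
  proof -
    have "Know (\<^bold>\<not> Know \<psi>) \<in> N"
      using that mcs_step[OF mcsN Five_K] mcs_Neg[OF mcsN] by blast
    then show ?thesis using L mcs_Neg by blast
  qed
  ultimately show ?thesis
    using N L(1) unfolding know_class_def by blast
qed

lemma box_rel_know_class:
  assumes N: "N \<in> know_class M" and L: "mcs L" "box_rel N L"
  shows "L \<in> know_class M"
proof (rule know_classI[OF N L(1)])
  have "mcs N" using N by (simp add: know_class_def)
  then show "{\<psi>. Know \<psi> \<in> N} \<subseteq> L"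
    using L(2) mcs_step[OF _ KI] unfolding box_rel_def by blast
qed

lemma know_class_Know:
  assumes N: "N \<in> know_class M"
  shows "Know \<phi> \<in> N \<longleftrightarrow> (\<forall>L\<in>know_class M. \<phi> \<in> L)"
proof
  show "\<forall>L\<in>know_class M. \<phi> \<in> L" if "Know \<phi> \<in> N"
    using that N mcs_step[OF _ T_K] unfolding know_class_def by blast
  show "Know \<phi> \<in> N" if "\<forall>L\<in>know_class M. \<phi> \<in> L"
    using that N know_classI[OF N] mcs_Know_witness[of N \<phi>]
    unfolding know_class_def[of M] by blast
qed

lemma know_class_Box:
  assumes N: "N \<in> know_class M"
  shows "Box \<phi> \<in> N \<longleftrightarrow>
    N \<in> canonical_topology M interior_of {L \<in> know_class M. \<phi> \<in> L}" (is "_ \<longleftrightarrow> _ \<in> ?I")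
proof
  assume Box: "Box \<phi> \<in> N"
  \<comment> \<open>An open neighbourhood of \<open>N\<close>: \<open>Four_Box\<close> makes it an
    up-set and \<open>T_Box\<close> puts \<phi> in each of its members.\<close>
  let ?V = "{L \<in> know_class M. Box \<phi> \<in> L}"
  have "openin (canonical_topology M) ?V"
    unfolding canonical_topology_def openin_upset_topology box_rel_def know_class_def
    using mcs_step[OF _ Four_Box] by blast
  moreover have "?V \<subseteq> {L \<in> know_class M. \<phi> \<in> L}"
    unfolding know_class_def using mcs_step[OF _ T_Box] by blast
  ultimately show "N \<in> ?I"
    using N Box unfolding interior_of_def by blast
next
  assume "N \<in> ?I"
  then obtain V where V: "openin (canonical_topology M) V" "N \<in> V" "\<forall>L\<in>V. \<phi> \<in> L"
    unfolding interior_of_def by blast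
  show "Box \<phi> \<in> N"
  proof (rule ccontr)
    assume "Box \<phi> \<notin> N"
    \<comment> \<open>A \<open>box_rel\<close>-successor of \<open>N\<close> omitting \<phi>. It
      stays in the class by (KI), hence in the up-set \<open>V\<close>, where \<phi> belongs to
      every member.\<close>
    then obtain L where L: "mcs L" "box_rel N L" "\<phi> \<notin> L"
      using N mcs_Box_witness[of N \<phi>] unfolding know_class_def box_rel_def by blast
    then have "L \<in> know_class M"
      using box_rel_know_class[OF N] by blast
    then have "L \<in> V"
      using V L unfolding canonical_topology_def openin_upset_topology by blast
    then show False using V L by blast
  qed
qed

lemma openin_know_class: "openin (canonical_topology M) (know_class M)"
  by (simp add: canonical_topology_def openin_upset_topology)

text \<open>The second component of the scenario is the whole class, so \<open>Know\<close> ranges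
  over exactly the worlds that matter for it.\<close>

lemma truth_lemma:
  assumes "N \<in> know_class M"
  shows "sat (canonical_topology M) (canonical_valuation M) N (know_class M) \<phi> \<longleftrightarrow> \<phi> \<in> N"
  using assms
proof (induction \<phi> arbitrary: N)
  case (Atom p)
  then show ?case by (simp add: canonical_valuation_def)
next
  case (Neg \<phi>)
  then show ?case by (simp add: mcs_Neg know_class_def)
next
  case (Conj \<phi> \<psi>)
  then show ?case by (simp add: mcs_Conj know_class_def)
next
  case (Know \<phi>)
  then show ?case by (simp add: know_class_Know)
next
  case (Box \<phi>)
  \<comment> \<open>\<open>conj_cong\<close> supplies membership in the class inside the set
    comprehension, where the induction hypothesis needs it.\<close>
  then show ?case by (simp add: know_class_Box cong: conj_cong)
next
  case (Bel \<phi>)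
  have Neg: "\<^bold>\<not> \<psi> \<in> L \<longleftrightarrow> \<psi> \<notin> L" if "L \<in> know_class M" for \<psi> L
    using that by (simp add: mcs_Neg know_class_def)
  have "Bel \<phi> \<in> N \<longleftrightarrow> Know (Dia (Box \<phi>)) \<in> N"
    using Bel.prems by (intro mcs_Bel_iff_Know_Dia_Box) (simp add: know_class_def)
  \<comment> \<open>\<open>Know (Dia (Box \<phi>))\<close> is not a subformula of
    \<open>Bel \<phi>\<close>, so the induction is not applied to it: its modalities are unfolded
    down to \<phi>.\<close>
  also have "\<dots> \<longleftrightarrow> sat (canonical_topology M) (canonical_valuation M) N (know_class M)
      (Know (Dia (Box \<phi>)))"
    using Bel.prems
    by (simp add: Bel.IH know_class_Know know_class_Box Neg cong: conj_cong)
  finally show ?case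
    unfolding sat_Bel_iff_Know_Dia_Box[OF openin_know_class] by simp
qed

lemma completeness:
  fixes \<phi> :: "'p fm"
  assumes "\<And>(T :: 'p fm set topology) v. topological_subset_model T v \<Longrightarrow> valid_in T v \<phi>"
  shows "\<turnstile> \<phi>"
proof (rule ccontr)
  assume "\<not> \<turnstile> \<phi>"
  then obtain M where M: "mcs M" "\<phi> \<notin> M"
    using lindenbaum[of "{}" \<phi>] deriv_empty by blast
  let ?T = "canonical_topology M" and ?v = "canonical_valuation M"
  have mem: "M \<in> know_class M"
    using M by (simp add: know_class_def)
  have sub: "know_class M \<subseteq> topspace ?T"
    using openin_know_class by (rule openin_subset)
  have "topological_subset_model ?T ?v"
    unfolding topological_subset_model_def canonical_valuation_def using mem sub by blast
  then have "sat ?T ?v M (know_class M) \<phi>"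
    using assms mem openin_know_class unfolding valid_in_def epistemic_scenario_def by blast
  then show False
    using truth_lemma[OF mem] M by blast
qed

text \<open>A formula of HOL cannot quantify over types: soundness is given for an arbitrary point
  type \<open>'x\<close>, and the equivalence at the point type of the canonical model.\<close>

theorem theorem5:
  fixes \<phi> :: "('p :: countable) fm"
  shows "((\<turnstile> \<phi>) \<longrightarrow>
            (\<forall>(T :: 'x topology) v. topological_subset_model T v \<longrightarrow> valid_in T v \<phi>))
       \<and> ((\<forall>(T :: 'p fm set topology) v. topological_subset_model T v \<longrightarrow> valid_in T v \<phi>)
            \<longleftrightarrow> (\<turnstile> \<phi>))"
  by (auto simp: valid_in_def epistemic_scenario_def intro: soundness completeness)

end
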